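(* For all $m=0,1,\ldots$ and $0<\xi<\infty$, $$\frac1\pi\int_0^\infty\frac{e^{-\eta/2}L_m^{-1/2}(\eta)\,d\eta}{(\eta-\xi)\sqrt\eta}=\frac{(-1)^mG_{2m}(\sqrt\xi)}{2^{2m}m!\,\sqrt\xi},$$ $$\frac1\pi\int_0^\infty\frac{e^{-\eta/2}L_m^{1/2}(\eta)\sqrt\eta\,d\eta}{\eta-\xi}=\frac{(-1)^mG_{2m+1}(\sqrt\xi)}{2^{2m+1}m!},$$ where $G_n(x)=\frac1\pi\int_{-\infty}^\infty\frac{e^{-t^2/2}H_n(t)}{t-x}\,dt$ for real $x$.
   Context: All singular integrals are Cauchy principal values. $H_n$ are the Hermite polynomials orthogonal on $(-\infty,\infty)$ with weight $e^{-x^2}$ and with leading coefficient $2^n$. $L_m^\alpha(x)=\sum_{k=0}^m\binom{m+\alpha}{m-k}\frac{(-1)^kx^k}{k!}$ are the (generalized) Laguerre polynomials, with $\binom{a}{n}=\frac{\Gamma(a+1)}{n!\,\Gamma(a-n+1)}$. *)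

theory Defs
  imports "HOL-Probability.Probability" "HOL-Computational_Algebra.Polynomial"
    "HOL-Real_Asymp.Real_Asymp"
begin

section \<open>Cauchy principal values\<close>

text \<open>
  The principal value over \<open>S\<close> of an integrand with a singularity at \<open>c\<close>: a symmetric
  neighbourhood of \<open>c\<close> is removed and then shrunk. Away from \<open>c\<close> the integrand has to be
  (absolutely) Lebesgue integrable, so no symmetric limit is taken at infinity.
\<close>

definition pv_truncated :: "real set \<Rightarrow> real \<Rightarrow> (real \<Rightarrow> real) \<Rightarrow> real \<Rightarrow> real" where
  "pv_truncated S c f \<epsilon> = (LINT t:(S - {c - \<epsilon>..c + \<epsilon>})|lborel. f t)"

definition pv_integrable :: "real set \<Rightarrow> real \<Rightarrow> (real \<Rightarrow> real) \<Rightarrow> bool" where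
  "pv_integrable S c f \<longleftrightarrow>
     (\<forall>\<epsilon>>0. set_integrable lborel (S - {c - \<epsilon>..c + \<epsilon>}) f) \<and>
     (\<exists>I. (pv_truncated S c f \<longlongrightarrow> I) (at_right 0))"

definition pv_integral :: "real set \<Rightarrow> real \<Rightarrow> (real \<Rightarrow> real) \<Rightarrow> real" where
  "pv_integral S c f = Lim (at_right 0) (pv_truncated S c f)"

section \<open>Laguerre polynomials\<close>

definition laguerre :: "nat \<Rightarrow> real \<Rightarrow> real \<Rightarrow> real" where
  "laguerre m \<alpha> x =
     (\<Sum>k\<le>m. ((real m + \<alpha>) gchoose (m - k)) * ((-1) ^ k * x ^ k / fact k))"

lemma laguerre_Gamma:
  assumes "\<alpha> > -1"
  shows "laguerre m \<alpha> x =
    (\<Sum>k\<le>m. Gamma (real m + \<alpha> + 1) /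
        (fact (m - k) * Gamma (real m + \<alpha> - real (m - k) + 1)) * ((-1) ^ k * x ^ k / fact k))"
proof -
  have "real m + \<alpha> + 1 \<notin> \<int>\<^sub>\<le>\<^sub>0"
    using assms by (auto elim!: nonpos_Ints_cases)
  then show ?thesis
    unfolding laguerre_def by (simp add: gbinomial_Gamma)
qed

section \<open>Hermite polynomials\<close>

definition hermite_family :: "(nat \<Rightarrow> real poly) \<Rightarrow> bool" where
  "hermite_family H \<longleftrightarrow>
     (\<forall>n. degree (H n) = n \<and> lead_coeff (H n) = 2 ^ n) \<and>
     (\<forall>m n. m \<noteq> n \<longrightarrow>
        (LINT x|lborel. exp (- x\<^sup>2) * (poly (H m) x * poly (H n) x)) = 0)"

definition hermite :: "nat \<Rightarrow> real poly" where
  "hermite = (THE H. hermite_family H)"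

text \<open>The description defining \<open>hermite\<close> is proper: there is exactly one such family.\<close>

lemma integrable_gauss_poly:
  "integrable lborel (\<lambda>x::real. exp (- x\<^sup>2) * poly p x)"
proof -
  have *: "integrable lborel (\<lambda>x::real. exp (- x\<^sup>2) * x ^ k)" for k
  proof -
    have "integrable lborel (\<lambda>x. normal_density 0 (1 / sqrt 2) x * (x - 0) ^ k)"
      by (rule integrable_normal_moment) auto
    then have "integrable lborel (\<lambda>x. sqrt pi * (normal_density 0 (1 / sqrt 2) x * x ^ k))"
      by simp
    then show ?thesis
      by (simp add: normal_density_def power_divide field_simps)
  qed
  have "integrable lborel (\<lambda>x::real. \<Sum>k\<le>degree p. coeff p k * (exp (- x\<^sup>2) * x ^ k))"
    by (intro Bochner_Integration.integrable_sum integrable_mult_right *)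
  then show ?thesis
    by (simp add: poly_altdef sum_distrib_left mult_ac)
qed

lemma gauss_poly_tendsto:
  "((\<lambda>x::real. exp (- x\<^sup>2) * poly p x) \<longlongrightarrow> 0) at_top"
  "((\<lambda>x::real. exp (- x\<^sup>2) * poly p x) \<longlongrightarrow> 0) at_bot"
proof -
  have *: "((\<lambda>x::real. exp (- x\<^sup>2) * x ^ k) \<longlongrightarrow> 0) at_top" for k
    by real_asymp
  show 1: "((\<lambda>x::real. exp (- x\<^sup>2) * poly p x) \<longlongrightarrow> 0) at_top" for p
  proof -
    have "((\<lambda>x::real. \<Sum>k\<le>degree p. coeff p k * (exp (- x\<^sup>2) * x ^ k))
             \<longlongrightarrow> (\<Sum>k\<le>degree p. coeff p k * 0)) at_top"
      by (intro tendsto_sum tendsto_mult tendsto_const *)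
    then show ?thesis
      by (simp add: poly_altdef sum_distrib_left mult_ac)
  qed
  show "((\<lambda>x::real. exp (- x\<^sup>2) * poly p x) \<longlongrightarrow> 0) at_bot"
    using 1[of "pcompose p [:0, -1:]"] by (simp add: filterlim_at_bot_mirror poly_pcompose)
qed

lemma integral_gauss_poly_deriv:
  "(LINT x|lborel. exp (- x\<^sup>2) * poly (pderiv p - [:0, 2:] * p) x) = (0::real)"
proof -
  have "(LBINT x=-\<infinity>..\<infinity>. exp (- x\<^sup>2) * poly (pderiv p - [:0, 2:] * p) x) = (0::real) - 0"
  proof (rule interval_integral_FTC_integrable[where F = "\<lambda>x. exp (- x\<^sup>2) * poly p x"])
    show "((\<lambda>x. exp (- x\<^sup>2) * poly p x) has_vector_derivative
            exp (- x\<^sup>2) * poly (pderiv p - [:0, 2:] * p) x) (at x)" for x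
      unfolding has_real_derivative_iff_has_vector_derivative[symmetric]
      by (auto intro!: derivative_eq_intros simp: algebra_simps)
    show "set_integrable lborel (einterval (-\<infinity>) \<infinity>)
            (\<lambda>x. exp (- x\<^sup>2) * poly (pderiv p - [:0, 2:] * p) x)"
      unfolding set_integrable_def
      using integrable_gauss_poly[of "pderiv p - [:0, 2:] * p"] by (simp del: poly_diff poly_mult)
    show "(((\<lambda>x. exp (- x\<^sup>2) * poly p x) \<circ> real_of_ereal) \<longlongrightarrow> 0) (at_right (- \<infinity>))"
      using gauss_poly_tendsto(2) by (simp add: ereal_tendsto_simps)
    show "(((\<lambda>x. exp (- x\<^sup>2) * poly p x) \<circ> real_of_ereal) \<longlongrightarrow> 0) (at_left \<infinity>)"
      using gauss_poly_tendsto(1) by (simp add: ereal_tendsto_simps)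
  qed (auto intro!: continuous_intros)
  then show ?thesis
    by (simp add: interval_integral_Icc interval_lebesgue_integral_def set_lebesgue_integral_def)
qed

fun hermite_rec :: "nat \<Rightarrow> real poly" where
  "hermite_rec 0 = 1"
| "hermite_rec (Suc n) = [:0, 2:] * hermite_rec n - pderiv (hermite_rec n)"

lemma hermite_rec_coeff:
  "degree (hermite_rec n) \<le> n \<and> coeff (hermite_rec n) n = 2 ^ n"
proof (induction n)
  case (Suc n)
  have "degree ([:0, 2:] * hermite_rec n) \<le> Suc n"
    using degree_mult_le[of "[:0, 2:]" "hermite_rec n"] Suc by simp
  moreover have "degree (pderiv (hermite_rec n)) \<le> Suc n"
    using Suc unfolding degree_pderiv by linarith
  ultimately have "degree (hermite_rec (Suc n)) \<le> Suc n"
    by (simp only: hermite_rec.simps) (rule degree_diff_le)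
  moreover have "coeff (pderiv (hermite_rec n)) (Suc n) = 0"
    by (rule coeff_eq_0) (use Suc degree_pderiv[of "hermite_rec n"] in linarith)
  ultimately show ?case
    using Suc by simp
qed simp

lemma hermite_rec_orthogonal:
  "degree q < n \<Longrightarrow> (LINT x|lborel. exp (- x\<^sup>2) * poly (hermite_rec n * q) x) = 0"
proof (induction n arbitrary: q)
  case (Suc n)
  have "(LINT x|lborel. exp (- x\<^sup>2) * poly (hermite_rec (Suc n) * q) x) =
        (LINT x|lborel. exp (- x\<^sup>2) * poly (hermite_rec n * pderiv q) x
           - exp (- x\<^sup>2) * poly (pderiv (hermite_rec n * q) - [:0, 2:] * (hermite_rec n * q)) x)"
    by (rule Bochner_Integration.integral_cong) (simp_all add: pderiv_mult algebra_simps)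
  also have "\<dots> = (LINT x|lborel. exp (- x\<^sup>2) * poly (hermite_rec n * pderiv q) x) - 0"
    by (subst Bochner_Integration.integral_diff)
       (simp_all only: integrable_gauss_poly integral_gauss_poly_deriv)
  also have "\<dots> = 0"
  proof (cases "pderiv q = 0")
    case False
    then have "degree (pderiv q) < n"
      using Suc.prems by (simp add: degree_pderiv pderiv_eq_0_iff)
    then show ?thesis
      using Suc.IH by simp
  qed simp
  finally show ?case .
qed simp

lemma hermite_family_hermite_rec: "hermite_family hermite_rec"
proof -
  have deg: "degree (hermite_rec n) = n" for n
    using hermite_rec_coeff[of n] le_degree[of "hermite_rec n" n] by simp
  have "(LINT x|lborel. exp (- x\<^sup>2) * (poly (hermite_rec m) x * poly (hermite_rec n) x)) = 0"
    if "m \<noteq> n" for m n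
    using that hermite_rec_orthogonal[of "hermite_rec m" n]
      hermite_rec_orthogonal[of "hermite_rec n" m]
    by (cases m n rule: linorder_cases) (simp_all add: deg mult.commute)
  then show ?thesis
    using hermite_rec_coeff deg unfolding hermite_family_def by simp
qed

lemma hermite_family_coeff:
  assumes "hermite_family H"
  shows "degree (H n) = n" "coeff (H n) n = 2 ^ n"
proof -
  show deg: "degree (H n) = n"
    using assms unfolding hermite_family_def by blast
  have "lead_coeff (H n) = 2 ^ n"
    using assms unfolding hermite_family_def by blast
  then show "coeff (H n) n = 2 ^ n"
    by (simp only: deg)
qed

lemma hermite_family_orthogonal:
  assumes "hermite_family H" "degree q < n"
  shows "(LINT x|lborel. exp (- x\<^sup>2) * poly (H n * q) x) = 0"
  using assms(2)
proof (induction "degree q" arbitrary: q rule: less_induct)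
  case less
  define d where "d = degree q"
  define c where "c = lead_coeff q / 2 ^ d"
  define r where "r = q - smult c (H d)"
  note Hd = hermite_family_coeff[OF assms(1), of d]
  have orth: "(LINT x|lborel. exp (- x\<^sup>2) * poly (H n * H d) x) = 0"
    using assms(1) less.prems unfolding hermite_family_def d_def by auto
  have r: "(LINT x|lborel. exp (- x\<^sup>2) * poly (H n * r) x) = 0"
  proof (cases "r = 0")
    case False
    have "degree r \<le> d" "coeff r d = 0"
      using Hd degree_smult_le[of c "H d"]
      by (auto simp: r_def c_def d_def intro!: degree_diff_le)
    then have "degree r < degree q"
      using False unfolding d_def by (metis leading_coeff_0_iff nless_le)
    then show ?thesis
      using less by simp
  qed simp
  have "(LINT x|lborel. exp (- x\<^sup>2) * poly (H n * q) x) =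
        (LINT x|lborel. c * (exp (- x\<^sup>2) * poly (H n * H d) x) + exp (- x\<^sup>2) * poly (H n * r) x)"
    by (rule Bochner_Integration.integral_cong) (simp_all add: r_def algebra_simps)
  also have "\<dots> = 0"
    using r orth
    by (subst Bochner_Integration.integral_add)
       (auto simp del: poly_mult intro!: integrable_mult_right integrable_gauss_poly)
  finally show ?case .
qed

lemma gauss_poly_square_eq_0:
  assumes "(LINT x|lborel. exp (- x\<^sup>2) * poly (p * p) x) = 0"
  shows "p = (0 :: real poly)"
proof (rule ccontr)
  assume "p \<noteq> 0"
  have "AE x in lborel. exp (- x\<^sup>2) * poly (p * p) x = 0"
    using assms integral_nonneg_eq_0_iff_AE[OF integrable_gauss_poly[of "p * p"]] by simp
  then have "AE x in lborel. poly p x = 0"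
    by simp
  moreover have "AE x in lborel. x \<notin> {x. poly p x = 0}"
    using poly_roots_finite[OF \<open>p \<noteq> 0\<close>]
    by (intro AE_not_in finite_imp_null_set_lborel)
  ultimately have "AE x in (lborel :: real measure). False"
    by eventually_elim simp
  then show False
    by (simp add: AE_iff_null emeasure_lborel_UNIV null_sets_def)
qed

lemma hermite_family_unique:
  assumes H: "hermite_family H" and K: "hermite_family K"
  shows "H = K"
proof
  fix n
  define D where "D = H n - K n"
  show "H n = K n"
  proof (rule ccontr)
    assume "H n \<noteq> K n"
    then have "D \<noteq> 0" by (simp add: D_def)
    note * = hermite_family_coeff[OF H, of n] hermite_family_coeff[OF K, of n]
    have "degree D \<le> n" "coeff D n = 0"
      using * by (auto simp: D_def intro!: degree_diff_le)
    then have deg: "degree D < n"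
      using \<open>D \<noteq> 0\<close> by (metis leading_coeff_0_iff nless_le)
    have "(LINT x|lborel. exp (- x\<^sup>2) * poly (D * D) x) =
          (LINT x|lborel. exp (- x\<^sup>2) * poly (H n * D) x - exp (- x\<^sup>2) * poly (K n * D) x)"
      by (rule Bochner_Integration.integral_cong) (simp_all add: D_def algebra_simps)
    also have "\<dots> = 0"
      using hermite_family_orthogonal[OF H deg] hermite_family_orthogonal[OF K deg]
      by (subst Bochner_Integration.integral_diff)
         (auto simp del: poly_mult intro!: integrable_gauss_poly)
    finally show False
      using gauss_poly_square_eq_0 \<open>D \<noteq> 0\<close> by blast
  qed
qed

lemma hermite_family_hermite: "hermite_family hermite"
  unfolding hermite_def
  using theI[of hermite_family, OF hermite_family_hermite_rec
    hermite_family_unique[OF _ hermite_family_hermite_rec]] .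

section \<open>The functions \<open>G\<^sub>n\<close>\<close>

definition G_integrand :: "nat \<Rightarrow> real \<Rightarrow> real \<Rightarrow> real" where
  "G_integrand n x t = exp (- t\<^sup>2 / 2) * poly (hermite n) t / (t - x)"

definition G :: "nat \<Rightarrow> real \<Rightarrow> real" where
  "G n x = 1 / pi * pv_integral UNIV x (G_integrand n x)"

end

(*
  With phi(t) = exp(-t^2/2) H_n(t) and x = sqrt xi, folding the line onto the half line turns
  phi(t)/(t - x) into phi(t)/(t - x) - phi(-t)/(t + x), and eta = t^2 then gives the two
  integrands, because H_{2m}(t) and H_{2m+1}(t) are multiples of L_m^{-1/2}(t^2) and
  t L_m^{1/2}(t^2). The substitution does not carry symmetric neighbourhoods of x to symmetric
  neighbourhoods of xi, so it is not applied to the truncated integrals: the pole is subtracted on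
  a bounded interval, where its principal value is an explicit logarithm, and only the absolutely
  integrable remainder is substituted.
*)
theory Submission
  imports Defs
begin

section \<open>Principal values of a simple pole plus an integrable remainder\<close>

text \<open>On either side of \<open>s\<close> the logarithm of the distance to \<open>s\<close> is
  an antiderivative of \<open>1 / (t - s)\<close>; the absolute values let one formula serve both
  sides of the pole.\<close>

lemma has_bochner_integral_inverse_diff:
  fixes a b s :: real
  assumes "a < b" "s < a \<or> b < s"
  shows "has_bochner_integral lborel (\<lambda>t. 1 / (t - s) * indicator {a..b} t)
    ((ln \<bar>b - s\<bar>) - (ln \<bar>a - s\<bar>))"
  using assms(2)
proof
  assume s: "s < a"
  have "has_bochner_integral lborel (\<lambda>t. 1 / (t - s) * indicator {a..b} t) (ln (b - s) - ln (a - s))"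
    by (rule has_bochner_integral_FTC_Icc_real)
      (use assms(1) s in \<open>auto intro!: derivative_eq_intros continuous_intros\<close>)
  then show ?thesis
    using s assms(1) by simp
next
  assume s: "b < s"
  have "has_bochner_integral lborel (\<lambda>t. 1 / (t - s) * indicator {a..b} t) (ln (s - b) - ln (s - a))"
    by (rule has_bochner_integral_FTC_Icc_real)
      (use assms(1) s in \<open>auto intro!: derivative_eq_intros continuous_intros simp: divide_simps\<close>)
  then show ?thesis
    using s assms(1) by (simp add: abs_minus_commute)
qed

text \<open>The cut-off ends contribute \<open>ln e\<close> and \<open>- ln e\<close>, which cancel.
  The truncated integral is therefore constant for small \<open>e\<close>, and no limit has to be
  taken.\<close>

lemma pv_truncated_pole:
  fixes a b s :: real
  assumes S: "{a<..<b} \<subseteq> S" and e: "0 < e" "e < s - a" "e < b - s"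
  shows "pv_truncated S s (\<lambda>t. indicator {a<..<b} t / (t - s)) e = ln ((b - s) / (s - a))"
proof -
  have 1: "has_bochner_integral lborel (\<lambda>t. 1 / (t - s) * indicator {a..s - e} t)
      ((ln \<bar>s - e - s\<bar>) - (ln \<bar>a - s\<bar>))"
    and 2: "has_bochner_integral lborel (\<lambda>t. 1 / (t - s) * indicator {s + e..b} t)
      ((ln \<bar>b - s\<bar>) - (ln \<bar>s + e - s\<bar>))"
    by (rule has_bochner_integral_inverse_diff; use e in simp)+
  have "pv_truncated S s (\<lambda>t. indicator {a<..<b} t / (t - s)) e =
      (LINT t|lborel. 1 / (t - s) * indicator {a..s - e} t + 1 / (t - s) * indicator {s + e..b} t)"
    unfolding pv_truncated_def set_lebesgue_integral_def
  \<comment> \<open>The exceptional points are the endpoints, where open and closed intervals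
    disagree.\<close>
  proof (rule integral_discrete_difference[where X = "{a, s - e, s + e, b}"])
    fix t assume "t \<notin> {a, s - e, s + e, b}"
    then show "indicator (S - {s - e..s + e}) t *\<^sub>R (indicator {a<..<b} t / (t - s)) =
       1 / (t - s) * indicator {a..s - e} t + 1 / (t - s) * indicator {s + e..b} t"
      using e S by (auto simp: indicator_def)
  qed auto
  also have "\<dots> = ((ln \<bar>s - e - s\<bar>) - (ln \<bar>a - s\<bar>)) + ((ln \<bar>b - s\<bar>) - (ln \<bar>s + e - s\<bar>))"
    using has_bochner_integral_add[OF 1 2] by (rule has_bochner_integral_integral_eq)
  also have "\<dots> = ln ((b - s) / (s - a))"
    using e by (simp add: ln_div)
  finally show ?thesis .
qed

text \<open>Dominated convergence, with the norm of \<open>h\<close> on \<open>S\<close> as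
  majorant: if \<open>t\<close> differs from \<open>s\<close>, the removed interval eventually
  misses \<open>t\<close>, and the point \<open>s\<close> itself is null.\<close>

lemma pv_truncated_tendsto:
  fixes s :: real
  assumes S: "S \<in> sets borel" and h: "set_integrable lborel S h"
  shows "(pv_truncated S s h \<longlongrightarrow> (LINT t:S|lborel. h t)) (at_right 0)"
\<comment> \<open>Dominated convergence is applied along sequences of positive radii tending to
  0.\<close>
proof (rule tendsto_at_right_sequentially[OF zero_less_one])
  fix E :: "nat \<Rightarrow> real" assume E: "\<And>n. 0 < E n" "E \<longlonglongrightarrow> 0"
  have m1 [measurable]: "(\<lambda>t. indicator S t *\<^sub>R h t) \<in> borel_measurable lborel"
    using h unfolding set_integrable_def by simp
  have m2: "(\<lambda>t. indicator S t *\<^sub>R h t * indicator (- {s - E n..s + E n}) t)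
      \<in> borel_measurable lborel" for n
    by measurable
  have eq: "indicator (S - {s - e..s + e}) t *\<^sub>R h t = (indicator S t *\<^sub>R h t) * indicator (- {s - e..s + e}) t" for e t
    by (simp add: indicator_def)
  show "(\<lambda>n. pv_truncated S s h (E n)) \<longlonglongrightarrow> (LINT t:S|lborel. h t)"
    unfolding pv_truncated_def set_lebesgue_integral_def eq
  proof (rule integral_dominated_convergence[where w = "\<lambda>t. norm (indicator S t *\<^sub>R h t)"])
    show "integrable lborel (\<lambda>t. norm (indicator S t *\<^sub>R h t))"
      using h unfolding set_integrable_def by (rule integrable_norm)
    show "AE t in lborel. (\<lambda>n. indicator S t *\<^sub>R h t * indicator (- {s - E n..s + E n}) t)
        \<longlonglongrightarrow> indicator S t *\<^sub>R h t"
    proof (rule AE_mp[OF AE_lborel_singleton[of s]], rule AE_I2, rule impI)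
      fix t assume "t \<noteq> s"
      then have "0 < \<bar>t - s\<bar>" by simp
      then have "\<forall>\<^sub>F n in sequentially. E n < \<bar>t - s\<bar>"
        by (rule order_tendstoD(2)[OF E(2)])
      then have "\<forall>\<^sub>F n in sequentially.
          indicator S t *\<^sub>R h t = indicator S t *\<^sub>R h t * indicator (- {s - E n..s + E n}) t"
        by eventually_elim (auto simp: indicator_def)
      then show "(\<lambda>n. indicator S t *\<^sub>R h t * indicator (- {s - E n..s + E n}) t)
          \<longlonglongrightarrow> indicator S t *\<^sub>R h t"
        by (rule tendsto_eventually[OF eventually_mono]) simp
    qed
    show "AE t in lborel. norm (indicator S t *\<^sub>R h t * indicator (- {s - E n..s + E n}) t) \<le>
        norm (indicator S t *\<^sub>R h t)" for n
      by (rule AE_I2) (simp add: indicator_def)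
  qed (rule m1 m2)+
qed

text \<open>Confining the pole to a bounded interval keeps it integrable on every truncation even if
  \<open>S\<close> is unbounded. The interval need not be symmetric about \<open>s\<close>; the
  logarithm measures the asymmetry. Every removed interval contains \<open>s\<close>, so the value
  of \<open>f\<close> there is free.\<close>

lemma
  fixes a b s c :: real
  assumes S: "S \<in> sets borel" "{a<..<b} \<subseteq> S" and s: "a < s" "s < b"
    and h: "set_integrable lborel S h"
    and f: "\<And>t. t \<in> S \<Longrightarrow> t \<noteq> s \<Longrightarrow> f t = h t + c * (indicator {a<..<b} t / (t - s))"
  shows pv_integrable_split: "pv_integrable S s f"
    and pv_integral_split:
      "pv_integral S s f = (LINT t:S|lborel. h t) + c * ln ((b - s) / (s - a))"
proof -
  define k where "k t = indicator {a<..<b} t / (t - s)" for t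
  have hT: "set_integrable lborel (S - {s - e..s + e}) h" for e
    by (rule set_integrable_subset[OF h]) (use S in auto)
  have kT: "set_integrable lborel (S - {s - e..s + e}) k" if e: "0 < e" for e
    unfolding set_integrable_def
  proof (rule Bochner_Integration.integrable_bound)
    \<comment> \<open>Off the removed interval the distance to \<open>s\<close> exceeds
      \<open>e\<close>, so the kernel is at most \<open>1 / e\<close> on a set of finite
      measure.\<close>
    show "integrable lborel (\<lambda>t. indicator {a<..<b} t * (1 / e))"
      using s by (intro integrable_mult_left integrable_real_indicator) auto
    show "(\<lambda>t. indicator (S - {s - e..s + e}) t *\<^sub>R k t) \<in> borel_measurable lborel"
      unfolding k_def using S by measurable
    show "AE t in lborel. norm (indicator (S - {s - e..s + e}) t *\<^sub>R k t) \<le> norm (indicator {a<..<b} t * (1 / e))"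
      using e by (auto simp: k_def indicator_def field_simps abs_if)
  qed
  have fT: "indicator (S - {s - e..s + e}) t *\<^sub>R f t =
      indicator (S - {s - e..s + e}) t *\<^sub>R (h t + c * k t)" if "0 < e" for e t
    using f[of t] that by (cases "t = s") (auto simp: k_def indicator_def)
  have int: "set_integrable lborel (S - {s - e..s + e}) f" if e: "0 < e" for e
    unfolding set_integrable_def fT[OF e]
    using set_integral_add(1)[OF hT set_integrable_mult_right[OF kT[OF e]], of c]
    unfolding set_integrable_def .
  have trunc: "pv_truncated S s f e = pv_truncated S s h e + c * ln ((b - s) / (s - a))"
    if e: "0 < e" "e < s - a" "e < b - s" for e
  proof -
    have "pv_truncated S s f e = (LINT t:(S - {s - e..s + e})|lborel. h t + c * k t)"
      unfolding pv_truncated_def set_lebesgue_integral_def fT[OF e(1)] ..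
    also have "\<dots> = pv_truncated S s h e + c * pv_truncated S s k e"
      unfolding pv_truncated_def
      by (subst set_integral_add(2)) (use hT kT[OF e(1)] in auto)
    finally show ?thesis
      using pv_truncated_pole[OF S(2) e] by (simp add: k_def[abs_def])
  qed
  have lim: "(pv_truncated S s f \<longlongrightarrow> (LINT t:S|lborel. h t) + c * ln ((b - s) / (s - a))) (at_right 0)"
  proof (rule Lim_transform_eventually)
    show "((\<lambda>e. pv_truncated S s h e + c * ln ((b - s) / (s - a))) \<longlongrightarrow>
        (LINT t:S|lborel. h t) + c * ln ((b - s) / (s - a))) (at_right 0)"
      by (intro tendsto_intros pv_truncated_tendsto S h)
    have "\<forall>\<^sub>F e in at_right 0. e \<in> {0<..<min (s - a) (b - s)}"
      using s by (intro eventually_at_rightI[of 0 "min (s - a) (b - s)"]) auto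
    then show "\<forall>\<^sub>F e in at_right 0. pv_truncated S s h e + c * ln ((b - s) / (s - a)) = pv_truncated S s f e"
      by eventually_elim (use trunc in auto)
  qed
  show "pv_integrable S s f"
    unfolding pv_integrable_def using int lim by blast
  show "pv_integral S s f = (LINT t:S|lborel. h t) + c * ln ((b - s) / (s - a))"
    unfolding pv_integral_def by (rule tendsto_Lim[OF _ lim]) simp
qed

section \<open>Folding the line and substituting the square\<close>

text \<open>Near \<open>x\<close> this is a difference quotient of \<phi>, bounded because the
  derivative exists. Farther away the kernel is bounded, and \<phi> and the cut-off constant are
  integrable.\<close>

lemma integrable_quotient_minus_pole:
  fixes \<phi> :: "real \<Rightarrow> real"
  assumes \<phi>: "integrable lborel \<phi>" and D: "(\<phi> has_real_derivative D) (at x)" and x: "a < x" "x < b"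
  shows "integrable lborel (\<lambda>t. \<phi> t / (t - x) - \<phi> x * (indicator {a<..<b} t / (t - x)))"
proof -
  have [measurable]: "\<phi> \<in> borel_measurable borel"
    using borel_measurable_integrable[OF \<phi>] by simp
  have "((\<lambda>t. \<bar>(\<phi> t - \<phi> x) / (t - x)\<bar>) \<longlongrightarrow> \<bar>D\<bar>) (at x)"
    using D unfolding has_field_derivative_iff by (rule tendsto_rabs)
  then have "\<forall>\<^sub>F t in at x. \<bar>(\<phi> t - \<phi> x) / (t - x)\<bar> < \<bar>D\<bar> + 1"
    by (rule order_tendstoD(2)) simp
  then obtain d where d: "d > 0" "\<And>t. t \<noteq> x \<Longrightarrow> dist t x < d \<Longrightarrow> \<bar>(\<phi> t - \<phi> x) / (t - x)\<bar> < \<bar>D\<bar> + 1"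
    unfolding eventually_at by auto
  \<comment> \<open>The radius also stays inside \<open>{a<..<b}\<close>, so the indicator is 1
    wherever the difference quotient is used.\<close>
  define \<delta> where "\<delta> = min d (min (x - a) (b - x))"
  have \<delta>: "\<delta> > 0" "\<delta> \<le> d" "\<delta> \<le> x - a" "\<delta> \<le> b - x"
    using d x by (auto simp: \<delta>_def)
  show ?thesis
  proof (rule Bochner_Integration.integrable_bound)
    show "integrable lborel (\<lambda>t. (\<bar>D\<bar> + 1) * indicator {a<..<b} t +
        (norm (\<phi> t) / \<delta> + \<bar>\<phi> x\<bar> / \<delta> * indicator {a<..<b} t))"
      using \<phi> x by (intro Bochner_Integration.integrable_add integrable_mult_right integrable_divide integrable_norm
          integrable_real_indicator) auto
    show "AE t in lborel. norm (\<phi> t / (t - x) - \<phi> x * (indicator {a<..<b} t / (t - x))) \<le>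
        norm ((\<bar>D\<bar> + 1) * indicator {a<..<b} t +
          (norm (\<phi> t) / \<delta> + \<bar>\<phi> x\<bar> / \<delta> * indicator {a<..<b} t))"
    proof (rule AE_I2)
      fix t
      let ?i = "indicator {a<..<b} t :: real"
      have nn: "0 \<le> (\<bar>D\<bar> + 1) * ?i" "0 \<le> norm (\<phi> t) / \<delta> + \<bar>\<phi> x\<bar> / \<delta> * ?i"
        using \<delta> by auto
      have "\<bar>\<phi> t / (t - x) - \<phi> x * (?i / (t - x))\<bar> \<le>
        (\<bar>D\<bar> + 1) * ?i + (norm (\<phi> t) / \<delta> + \<bar>\<phi> x\<bar> / \<delta> * ?i)"
      proof (cases "t \<noteq> x \<and> \<bar>t - x\<bar> < \<delta>")
        case True
        then have i: "?i = 1"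
          using \<delta> by (auto simp: indicator_def)
        have "\<bar>(\<phi> t - \<phi> x) / (t - x)\<bar> < \<bar>D\<bar> + 1"
          using True \<delta> by (intro d(2)) (auto simp: dist_real_def)
        then show ?thesis
          using nn(2) unfolding i by (simp add: diff_divide_distrib)
      next
        case False
        \<comment> \<open>The point \<open>t = x\<close> falls under this case: division by zero
          makes the left side 0.\<close>
        have q: "\<bar>y / (t - x)\<bar> \<le> \<bar>y\<bar> / \<delta>" for y
        proof (cases "t = x")
          case False
          with \<open>\<not> (t \<noteq> x \<and> \<bar>t - x\<bar> < \<delta>)\<close> have "\<delta> \<le> \<bar>t - x\<bar>" by simp
          then show ?thesis
            using \<delta>(1) by (simp add: divide_left_mono)
        qed (use \<delta> in simp)
        have "\<bar>\<phi> t / (t - x) - \<phi> x * (?i / (t - x))\<bar> \<le> \<bar>\<phi> t / (t - x)\<bar> + \<bar>\<phi> x * ?i / (t - x)\<bar>"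
          by (simp only: times_divide_eq_right abs_triangle_ineq4)
        also have "\<dots> \<le> norm (\<phi> t) / \<delta> + \<bar>\<phi> x * ?i\<bar> / \<delta>"
          using q[of "\<phi> t"] q[of "\<phi> x * ?i"] by simp
        also have "\<dots> = norm (\<phi> t) / \<delta> + \<bar>\<phi> x\<bar> / \<delta> * ?i"
          by (simp add: abs_mult)
        finally show ?thesis
          using nn(1) by linarith
      qed
      then show "norm (\<phi> t / (t - x) - \<phi> x * (?i / (t - x))) \<le>
          norm ((\<bar>D\<bar> + 1) * ?i + (norm (\<phi> t) / \<delta> + \<bar>\<phi> x\<bar> / \<delta> * ?i))"
        using nn by simp
    qed
  qed measurable
qed

text \<open>Reflection at the origin carries the negative half line to the positive one, and the
  point 0 is null.\<close>

lemma integral_fold_half_line: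
  fixes h :: "real \<Rightarrow> real"
  assumes h: "integrable lborel h"
  shows "set_integrable lborel {0<..} (\<lambda>t. h t + h (- t))"
    and "(LINT t:{0<..}|lborel. h t + h (- t)) = (LINT t|lborel. h t)"
proof -
  have h': "integrable lborel (\<lambda>t. h (- t))"
    using lborel_integrable_real_affine[OF h, of "-1" 0] by simp
  have *: "set_integrable lborel A h" "set_integrable lborel A (\<lambda>t. h (- t))" if "A \<in> sets borel" for A
    using that h h' unfolding set_integrable_def by (auto intro!: integrable_mult_indicator[where 'b = real, simplified])
  show "set_integrable lborel {0<..} (\<lambda>t. h t + h (- t))"
    by (intro set_integral_add *) auto
  have "(LINT t|lborel. h t) = (LINT t|lborel. indicator {0<..} t *\<^sub>R h t + indicator {..<0} t *\<^sub>R h t)"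
    by (rule integral_discrete_difference[where X = "{0}"]) (auto simp: indicator_def)
  also have "\<dots> = (LINT t:{0<..}|lborel. h t) + (LINT t:{..<0}|lborel. h t)"
    unfolding set_lebesgue_integral_def
    by (intro Bochner_Integration.integral_add *[unfolded set_integrable_def]) auto
  also have "(LINT t:{..<0}|lborel. h t) = (LINT t:{0<..}|lborel. h (- t))"
    by (subst set_integral_reflect) (simp add: greaterThan_def)
  also have "(LINT t:{0<..}|lborel. h t) + \<dots> = (LINT t:{0<..}|lborel. h t + h (- t))"
    by (intro set_integral_add(2)[symmetric] *) auto
  finally show "(LINT t:{0<..}|lborel. h t + h (- t)) = (LINT t|lborel. h t)" by simp
qed

lemma set_integral_substitute_sqrt:
  fixes k :: "real \<Rightarrow> real"
  assumes [measurable]: "k \<in> borel_measurable borel" and k: "set_integrable lborel {0<..} k"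
  shows "set_integrable lborel {0<..} (\<lambda>u. k (sqrt u) / (2 * sqrt u))"
    and "(LINT u:{0<..}|lborel. k (sqrt u) / (2 * sqrt u)) = (LINT t:{0<..}|lborel. k t)"
proof -
  let ?k = "\<lambda>u. k (sqrt u) / (2 * sqrt u)"
  \<comment> \<open>The change of variables is carried out for \<open>lebesgue\<close>; for Borel
    functions integrability and value agree with those for \<open>lborel\<close>.\<close>
  have conv: "set_integrable lebesgue {0<..} f = set_integrable lborel {0<..} f"
    "(LINT t:{0<..}|lebesgue. f t) = (LINT t:{0<..}|lborel. f t)"
    if [measurable]: "f \<in> borel_measurable borel" for f :: "real \<Rightarrow> real"
    unfolding set_integrable_def set_lebesgue_integral_def
    by (simp_all add: integrable_completion integral_completion)
  have img: "(\<lambda>t::real. t\<^sup>2) ` {0<..} = {0<..}"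
  proof (intro set_eqI iffI)
    fix y :: real assume "y \<in> {0<..}"
    then show "y \<in> (\<lambda>t. t\<^sup>2) ` {0<..}"
      by (intro image_eqI[of _ _ "sqrt y"]) auto
  qed auto
  have eq: "\<bar>2 * t\<bar> * ?k (t\<^sup>2) = k t" if "t \<in> {0<..}" for t
    using that by simp
  have k': "k absolutely_integrable_on {0<..}"
    using k conv by simp
  then have "(\<lambda>t. \<bar>2 * t\<bar> * ?k (t\<^sup>2)) absolutely_integrable_on {0<..}"
    by (rule set_integrable_cong[THEN iffD1, rotated -1]) (use eq in auto)
  moreover have "integral {0<..} (\<lambda>t. \<bar>2 * t\<bar> * ?k (t\<^sup>2)) = integral {0<..} k"
    by (rule Henstock_Kurzweil_Integration.integral_cong) (rule eq)
  moreover have "((\<lambda>t. t\<^sup>2) has_field_derivative 2 * t) (at t within {0<..})" for t :: real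
    by (auto intro!: derivative_eq_intros)
  moreover have "{0<..} \<in> sets (lebesgue :: real measure)"
    by simp
  moreover have "inj_on (\<lambda>t::real. t\<^sup>2) {0<..}"
    by (auto simp: inj_on_def)
  ultimately have *: "?k absolutely_integrable_on {0<..} \<and> integral {0<..} ?k = integral {0<..} k"
    using has_absolute_integral_change_of_variables_1'[of "{0<..}" "\<lambda>t. t\<^sup>2" "\<lambda>t. 2 * t" ?k "integral {0<..} k"]
    unfolding img by metis
  then show "set_integrable lborel {0<..} ?k"
    by (simp add: conv)
  show "(LINT u:{0<..}|lborel. ?k u) = (LINT t:{0<..}|lborel. k t)"
    using * k' by (simp add: set_lebesgue_integral_eq_integral(2) flip: conv(2))
qed

text \<open>The pole is cut off at \<open>(0, 2x)\<close> in the variable \<open>t\<close>, that is at \<open>(0, 4x\<^sup>2)\<close> in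
  \<open>u = t\<^sup>2\<close>. This interval is symmetric about \<open>x\<close> but not about \<open>x\<^sup>2\<close>; the resulting
  \<open>\<phi>(x) ln 3\<close> cancels against the integral of \<open>\<phi>(x) / (t + x)\<close> over \<open>(0, 2x)\<close>.\<close>

lemma
  fixes \<phi> :: "real \<Rightarrow> real" and x :: real
  assumes \<phi>: "integrable lborel \<phi>" and D: "(\<phi> has_real_derivative D) (at x)" and x: "0 < x"
  defines "F \<equiv> \<lambda>u. (\<phi> (sqrt u) / (sqrt u - x) - \<phi> (- sqrt u) / (sqrt u + x)) / (2 * sqrt u)"
  shows pv_integrable_line: "pv_integrable UNIV x (\<lambda>t. \<phi> t / (t - x))"
    and pv_integrable_half_line: "pv_integrable {0<..} (x\<^sup>2) F"
    and pv_integral_half_line: "pv_integral {0<..} (x\<^sup>2) F = pv_integral UNIV x (\<lambda>t. \<phi> t / (t - x))"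
proof -
  have [measurable]: "\<phi> \<in> borel_measurable borel"
    using borel_measurable_integrable[OF \<phi>] by simp
  define h where "h t = \<phi> t / (t - x) - \<phi> x * (indicator {0<..<2 * x} t / (t - x))" for t
  have hm [measurable]: "h \<in> borel_measurable borel"
    unfolding h_def[abs_def] by measurable
  have h: "integrable lborel h"
    unfolding h_def[abs_def] by (rule integrable_quotient_minus_pole[OF \<phi> D]) (use x in auto)
  have hU: "set_integrable lborel UNIV h"
    using h unfolding set_integrable_def by simp
  have f: "\<phi> t / (t - x) = h t + \<phi> x * (indicator {0<..<2 * x} t / (t - x))" for t
    by (simp add: h_def)
  show "pv_integrable UNIV x (\<lambda>t. \<phi> t / (t - x))"
    by (rule pv_integrable_split[OF _ _ _ _ hU f]) (use x in auto)
  have line: "pv_integral UNIV x (\<lambda>t. \<phi> t / (t - x)) = (LINT t|lborel. h t)"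
    by (subst pv_integral_split[OF _ _ _ _ hU f]) (use x in \<open>auto simp: set_lebesgue_integral_def\<close>)

  \<comment> \<open>With \<open>u = t\<^sup>2\<close> and the Jacobian \<open>2 * t\<close>, the
    kernel \<open>1 / (u - x\<^sup>2)\<close> becomes \<open>1 / (t - x) + 1 / (t + x)\<close>. The
    first summand is the pole subtracted in \<open>h\<close>; \<open>r\<close> accounts for the
    second.\<close>
  define r where "r t = \<phi> x * (indicator {0<..<2 * x} t / (t + x))" for t
  have r: "has_bochner_integral lborel r (\<phi> x * ln 3)"
  proof -
    have "has_bochner_integral lborel (\<lambda>t. 1 / (t - - x) * indicator {0..2 * x} t)
        ((ln \<bar>2 * x - - x\<bar>) - (ln \<bar>0 - - x\<bar>))"
      using x by (intro has_bochner_integral_inverse_diff) auto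
    moreover have "((ln \<bar>2 * x - - x\<bar>) - (ln \<bar>0 - - x\<bar>)) = ln 3"
      using x by (simp add: ln_mult)
    ultimately have "has_bochner_integral lborel (\<lambda>t. 1 / (t - - x) * indicator {0..2 * x} t) (ln 3)"
      by simp
    also have "?this \<longleftrightarrow> has_bochner_integral lborel (\<lambda>t. indicator {0<..<2 * x} t / (t + x)) (ln 3)"
      by (rule has_bochner_integral_discrete_difference[where X = "{0, 2 * x}"])
        (auto simp: indicator_def)
    finally show ?thesis
      unfolding r_def[abs_def] by (rule has_bochner_integral_mult_right)
  qed
  have r_eq: "indicator {0<..} t *\<^sub>R r t = r t" for t
    by (simp add: r_def indicator_def)
  have ri: "set_integrable lborel {0<..} r" and rI: "(LINT t:{0<..}|lborel. r t) = \<phi> x * ln 3"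
    unfolding set_integrable_def set_lebesgue_integral_def r_eq
    using r by (simp_all add: has_bochner_integral_iff)
  \<comment> \<open>On the half line and away from \<open>x\<close>, this is the folded integrand
    minus the pulled-back pole of the variable \<open>u\<close>.\<close>
  define k where "k t = (h t + h (- t)) - r t" for t
  have km: "k \<in> borel_measurable borel"
    unfolding k_def[abs_def] r_def by measurable
  have ki: "set_integrable lborel {0<..} k"
    unfolding k_def[abs_def] by (intro set_integral_diff integral_fold_half_line h ri)
  have kI: "(LINT t:{0<..}|lborel. k t) = (LINT t|lborel. h t) - \<phi> x * ln 3"
    unfolding k_def[abs_def]
    by (subst set_integral_diff(2)) (use integral_fold_half_line[OF h] ri rI in simp_all)
  note ks = set_integral_substitute_sqrt[OF km ki]
  have F: "F u = k (sqrt u) / (2 * sqrt u) + \<phi> x * (indicator {0<..<4 * x\<^sup>2} u / (u - x\<^sup>2))"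
    if u: "u \<in> {0<..}" "u \<noteq> x\<^sup>2" for u
  proof -
    define t where "t = sqrt u"
    have t: "0 < t" "t \<noteq> x" "u = t\<^sup>2"
      using u by (auto simp: t_def)
    have lt: "t\<^sup>2 < 4 * x\<^sup>2 \<longleftrightarrow> t < 2 * x"
      using power_mono_iff[of "2 * x" t 2] t x by (simp add: power_mult_distrib flip: not_le)
    define i :: real where "i = indicator {0<..<2 * x} t"
    have i: "indicator {0<..<4 * x\<^sup>2} u = i"
      using t lt by (simp add: i_def indicator_def)
    have nz: "t - x \<noteq> 0" "t + x \<noteq> 0" "t \<noteq> 0" "t\<^sup>2 - x\<^sup>2 \<noteq> 0"
      using t x u by auto
    have ht: "h t + h (- t) - r t =
        (\<phi> t / (t - x) - \<phi> (- t) / (t + x)) - \<phi> x * i * (1 / (t - x) + 1 / (t + x))"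
    proof -
      \<comment> \<open>The reflected point \<open>- t\<close> lies outside
        \<open>{0<..<2 * x}\<close>, so no pole is subtracted there.\<close>
      have "h (- t) = - (\<phi> (- t) / (t + x))"
        using t x minus_divide_right[of "\<phi> (- t)" "t + x"] by (simp add: h_def)
      then show ?thesis
        by (simp add: h_def r_def i_def algebra_simps add_divide_distrib)
    qed
    have kernel: "(1 / (t - x) + 1 / (t + x)) / (2 * t) = 1 / (t\<^sup>2 - x\<^sup>2)"
      using nz by (simp add: divide_simps) (simp add: algebra_simps power2_eq_square)
    have pole: "\<phi> x * (i / (t\<^sup>2 - x\<^sup>2)) = \<phi> x * i * (1 / (t - x) + 1 / (t + x)) / (2 * t)"
      unfolding times_divide_eq_right[symmetric] kernel by simp
    show ?thesis
      unfolding i F_def k_def t_def[symmetric] ht unfolding t(3) pole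
      by (simp only: diff_divide_distrib diff_add_cancel)
  qed
  show "pv_integrable {0<..} (x\<^sup>2) F"
    by (rule pv_integrable_split[OF _ _ _ _ ks(1) F]) (use x in auto)
  have "pv_integral {0<..} (x\<^sup>2) F = (LINT t|lborel. h t) - \<phi> x * ln 3 + \<phi> x * ln ((4 * x\<^sup>2 - x\<^sup>2) / (x\<^sup>2 - 0))"
    unfolding kI[symmetric] ks(2)[symmetric]
    by (rule pv_integral_split[OF _ _ _ _ ks(1) F]) (use x in auto)
  then show "pv_integral {0<..} (x\<^sup>2) F = pv_integral UNIV x (\<lambda>t. \<phi> t / (t - x))"
    using x line by simp
qed

text \<open>Agreement away from \<open>s\<close> suffices because every truncation omits
  \<open>s\<close>. This carries the constants relating Hermite and Laguerre polynomials through the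
  principal value.\<close>

lemma
  fixes c s :: real
  assumes g: "pv_integrable S s g"
    and f: "\<And>t. t \<in> S \<Longrightarrow> t \<noteq> s \<Longrightarrow> f t = c * g t"
  shows pv_integrable_cmult: "pv_integrable S s f"
    and pv_integral_cmult: "pv_integral S s f = c * pv_integral S s g"
proof -
  have eq: "indicator (S - {s - e..s + e}) t *\<^sub>R f t =
      indicator (S - {s - e..s + e}) t *\<^sub>R (c * g t)" if "0 < e" for e t
    using f[of t] that by (cases "t = s") (auto simp: indicator_def)
  have int: "set_integrable lborel (S - {s - e..s + e}) f" if e: "0 < e" for e
    using g e set_integrable_mult_right[of c lborel "S - {s - e..s + e}" g]
    unfolding pv_integrable_def set_integrable_def eq[OF e] by blast
  have trunc: "pv_truncated S s f e = c * pv_truncated S s g e" if e: "0 < e" for e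
    unfolding pv_truncated_def set_lebesgue_integral_def eq[OF e]
    by (simp add: mult.left_commute)
  obtain I where I: "(pv_truncated S s g \<longlongrightarrow> I) (at_right 0)"
    using g unfolding pv_integrable_def by blast
  have lim: "(pv_truncated S s f \<longlongrightarrow> c * I) (at_right 0)"
  proof (rule Lim_transform_eventually)
    show "((\<lambda>e. c * pv_truncated S s g e) \<longlongrightarrow> c * I) (at_right 0)"
      by (intro tendsto_intros I)
    show "\<forall>\<^sub>F e in at_right 0. c * pv_truncated S s g e = pv_truncated S s f e"
      using eventually_at_right_less[of 0] by eventually_elim (simp add: trunc)
  qed
  show "pv_integrable S s f"
    unfolding pv_integrable_def using int lim by blast
  show "pv_integral S s f = c * pv_integral S s g"
    unfolding pv_integral_def tendsto_Lim[OF trivial_limit_at_right_real I]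
    by (rule tendsto_Lim[OF trivial_limit_at_right_real lim])
qed

section \<open>Ladder relations of the Laguerre polynomials and the Hermite polynomials\<close>

text \<open>A polynomial object behind \<open>laguerre\<close>, so that identities involving
  derivatives can be checked coefficient by coefficient.\<close>

definition laguerre_poly :: "nat \<Rightarrow> real \<Rightarrow> real poly" where
  "laguerre_poly m \<alpha> =
     (\<Sum>k\<le>m. monom (((real m + \<alpha>) gchoose (m - k)) * ((-1) ^ k / fact k)) k)"

lemma poly_laguerre_poly: "poly (laguerre_poly m \<alpha>) x = laguerre m \<alpha> x"
  by (simp add: laguerre_poly_def laguerre_def poly_sum poly_monom mult_ac)

lemma coeff_laguerre_poly:
  "coeff (laguerre_poly m \<alpha>) k =
     (if k \<le> m then ((real m + \<alpha>) gchoose (m - k)) * ((-1) ^ k / fact k) else 0)"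
  by (simp add: laguerre_poly_def coeff_sum)

text \<open>Differentiation lowers the lower binomial index by one and flips the sign, so each
  coefficient becomes a sum of two neighbouring binomials, which Pascal's rule combines.\<close>

lemma laguerre_poly_minus_pderiv:
  "laguerre_poly m \<alpha> - pderiv (laguerre_poly m \<alpha>) = laguerre_poly m (\<alpha> + 1)"
proof (rule poly_eqI)
  fix k
  have "k < m \<or> k = m \<or> m < k" by linarith
  then show "coeff (laguerre_poly m \<alpha> - pderiv (laguerre_poly m \<alpha>)) k = coeff (laguerre_poly m (\<alpha> + 1)) k"
  proof (elim disjE)
    assume "k < m"
    then obtain j where j: "m = k + Suc j"
      using less_natE by auto
    have "(real m + (\<alpha> + 1)) gchoose Suc j = ((real m + \<alpha>) gchoose j) + ((real m + \<alpha>) gchoose Suc j)"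
      using gbinomial_Suc_Suc[of "real m + \<alpha>" j] by (simp add: add_ac)
    then show ?thesis
      using j by (simp add: coeff_laguerre_poly coeff_pderiv divide_simps) (simp add: algebra_simps)
  qed (auto simp: coeff_laguerre_poly coeff_pderiv)
qed

text \<open>The companion relation, raising the degree and lowering \<alpha>. Coefficientwise it
  rests on \<open>(a - j) * (a gchoose j) = (j + 1) * (a gchoose (j + 1))\<close> with
  \<open>a = m + \<alpha>\<close> and \<open>j = m - k\<close>, where \<open>a - j\<close> is
  \<open>\<alpha> + k\<close>.\<close>

lemma laguerre_poly_Suc:
  "smult \<alpha> (laguerre_poly m \<alpha>) - [:0, 1:] * (laguerre_poly m \<alpha> - pderiv (laguerre_poly m \<alpha>)) =
     smult (real (Suc m)) (laguerre_poly (Suc m) (\<alpha> - 1))"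
proof (rule poly_eqI)
  fix k
  have X: "coeff ([:0, 1:] * p) k = (case k of 0 \<Rightarrow> 0 | Suc i \<Rightarrow> coeff p i)" for p :: "real poly"
    by (simp add: coeff_pCons)
  have *: "(\<alpha> + real k) * ((real m + \<alpha>) gchoose j) = real (Suc j) * ((real m + \<alpha>) gchoose Suc j)" if "m = k + j" for j
    using gbinomial_mult_1[of "real m + \<alpha>" j] that by (simp add: algebra_simps)
  consider "k \<le> m" | "k = Suc m" | "Suc m < k" by linarith
  then show "coeff (smult \<alpha> (laguerre_poly m \<alpha>) - [:0, 1:] * (laguerre_poly m \<alpha> - pderiv (laguerre_poly m \<alpha>))) k =
      coeff (smult (real (Suc m)) (laguerre_poly (Suc m) (\<alpha> - 1))) k"
  proof cases
    case 1
    then obtain j where j: "m = k + j"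
      using le_Suc_ex by auto
    show ?thesis
    proof (cases k)
      case 0
      then show ?thesis
        using *[OF j] j by (simp only: coeff_diff coeff_smult X) (simp add: coeff_laguerre_poly)
    next
      case (Suc i)
      have X': "coeff ([:0, 1:] * (laguerre_poly m \<alpha> - pderiv (laguerre_poly m \<alpha>))) k =
          ((real m + \<alpha>) gchoose Suc j) * ((- 1) ^ i / fact i) -
          real k * (((real m + \<alpha>) gchoose j) * ((- 1) ^ k / fact k))"
        unfolding X using Suc j by (simp add: coeff_laguerre_poly coeff_pderiv)
      \<comment> \<open>Multiplication by the variable shifted the index to \<open>i\<close>; this
        restores the common factor of index \<open>k = Suc i\<close>.\<close>
      have i: "(- 1) ^ i / fact i = - real k * ((- 1) ^ k / fact k)"
        unfolding Suc fact_Suc of_nat_mult by (simp del: of_nat_Suc)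
      have "coeff (smult \<alpha> (laguerre_poly m \<alpha>) - [:0, 1:] * (laguerre_poly m \<alpha> - pderiv (laguerre_poly m \<alpha>))) k =
          ((- 1) ^ k / fact k) * ((\<alpha> + real k) * ((real m + \<alpha>) gchoose j) + real k * ((real m + \<alpha>) gchoose Suc j))"
        unfolding coeff_diff X' i coeff_smult using j by (simp add: coeff_laguerre_poly algebra_simps)
      also have "\<dots> = real (Suc m) * (((real m + \<alpha>) gchoose Suc j) * ((- 1) ^ k / fact k))"
        unfolding *[OF j] using j by (simp add: algebra_simps add_divide_distrib)
      also have "\<dots> = coeff (smult (real (Suc m)) (laguerre_poly (Suc m) (\<alpha> - 1))) k"
        using j by (simp add: coeff_laguerre_poly Suc_diff_le add.assoc)
      finally show ?thesis .
    qed
  next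
    case 2
    then show ?thesis
      by (simp only: coeff_diff coeff_smult X) (simp add: coeff_laguerre_poly coeff_pderiv divide_simps)
  next
    case 3
    then show ?thesis
      by (simp only: coeff_diff coeff_smult X) (simp add: coeff_laguerre_poly coeff_pderiv split: nat.split)
  qed
qed

lemma hermite_eq_hermite_rec: "hermite = hermite_rec"
  using hermite_family_unique[OF hermite_family_hermite hermite_family_hermite_rec] .

text \<open>The recursion of \<open>hermite_rec\<close> alternates between even and odd degree. In
  the argument \<open>t\<^sup>2\<close> its two kinds of step are the two ladder relations, taken at
  -1/2 and at 1/2.\<close>

lemma hermite_laguerre:
  "poly (hermite (2 * m)) t = (- 1) ^ m * 2 ^ (2 * m) * fact m * laguerre m (- 1 / 2) (t\<^sup>2)"
  "poly (hermite (2 * m + 1)) t = (- 1) ^ m * 2 ^ (2 * m + 1) * fact m * t * laguerre m (1 / 2) (t\<^sup>2)"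
proof -
  let ?q = "[:0, 0, 1:] :: real poly"
  let ?E = "\<lambda>m. smult ((- 1) ^ m * 2 ^ (2 * m) * fact m) (laguerre_poly m (- (1 / 2)) \<circ>\<^sub>p ?q)"
  let ?O = "\<lambda>m. smult ((- 1) ^ m * 2 ^ (2 * m + 1) * fact m) ([:0, 1:] * (laguerre_poly m (1 / 2) \<circ>\<^sub>p ?q))"
  have dq: "pderiv ?q = [:0, 2:]"
    by (simp add: pderiv_pCons)
  \<comment> \<open>The chain rule puts a factor \<open>2 * t\<close> on the derivative as well,
    leaving \<open>2 * t\<close> times the first ladder relation at
    \<open>t\<^sup>2\<close>.\<close>
  have odd: "[:0, 2:] * ?E m - pderiv (?E m) = ?O m" for m
  proof (rule poly_ext)
    fix t
    have "poly (laguerre_poly m (- (1 / 2))) (t * t) =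
        poly (laguerre_poly m (1 / 2)) (t * t) + poly (pderiv (laguerre_poly m (- (1 / 2)))) (t * t)"
      using arg_cong[OF laguerre_poly_minus_pderiv[of m "- (1 / 2)"], of "\<lambda>p. poly p (t * t)"] by simp
    then show "poly ([:0, 2:] * ?E m - pderiv (?E m)) t = poly (?O m) t"
      by (simp add: pderiv_smult pderiv_pcompose dq poly_pcompose algebra_simps)
  qed
  \<comment> \<open>The left side contains \<open>- 2\<close> times the second ladder relation:
    \<open>- 2\<close> supplies the next sign and power of 2, and \<open>real (Suc m)\<close>
    completes the factorial.\<close>
  have even: "[:0, 2:] * ?O m - pderiv (?O m) = ?E (Suc m)" for m
  proof (rule poly_ext)
    fix t
    define L where "L = poly (laguerre_poly m (1 / 2)) (t * t)"
    define D where "D = poly (pderiv (laguerre_poly m (1 / 2))) (t * t)"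
    define M where "M = poly (laguerre_poly (Suc m) (- (1 / 2))) (t * t)"
    have *: "real (Suc m) * M = 1 / 2 * L - t * t * (L - D)"
      using arg_cong[OF laguerre_poly_Suc[of "1 / 2" m], of "\<lambda>p. poly p (t * t)"]
      by (simp add: L_def D_def M_def)
    have "poly ([:0, 2:] * ?O m - pderiv (?O m)) t =
        (- 1) ^ m * 2 ^ (2 * m + 1) * fact m * (2 * (t * t) * (L - D) - L)"
      by (simp add: pderiv_smult pderiv_mult pderiv_pCons pderiv_pcompose dq poly_pcompose L_def D_def algebra_simps)
    also have "\<dots> = (- 1) ^ Suc m * 2 ^ (2 * Suc m) * fact m * (real (Suc m) * M)"
      unfolding * by (simp add: algebra_simps)
    also have "\<dots> = poly (?E (Suc m)) t"
      by (simp add: poly_pcompose M_def algebra_simps)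
    finally show "poly ([:0, 2:] * ?O m - pderiv (?O m)) t = poly (?E (Suc m)) t" .
  qed
  have main: "hermite_rec (2 * m) = ?E m"
  proof (induction m)
    case 0
    then show ?case
      by (simp add: laguerre_poly_def monom_0 pcompose_pCons)
  next
    case (Suc m)
    have "hermite_rec (2 * Suc m) = [:0, 2:] * hermite_rec (Suc (2 * m)) - pderiv (hermite_rec (Suc (2 * m)))"
      by simp
    also have "hermite_rec (Suc (2 * m)) = ?O m"
      unfolding hermite_rec.simps Suc by (rule odd)
    finally show ?case
      unfolding even .
  qed
  have "hermite_rec (2 * m + 1) = ?O m"
    using odd by (simp only: Suc_eq_plus1[symmetric] hermite_rec.simps main)
  with main show
    "poly (hermite (2 * m)) t = (- 1) ^ m * 2 ^ (2 * m) * fact m * laguerre m (- 1 / 2) (t\<^sup>2)"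
    "poly (hermite (2 * m + 1)) t = (- 1) ^ m * 2 ^ (2 * m + 1) * fact m * t * laguerre m (1 / 2) (t\<^sup>2)"
    unfolding hermite_eq_hermite_rec
    by (simp_all add: poly_pcompose poly_laguerre_poly power2_eq_square del: hermite_rec.simps)
qed

section \<open>The two transforms\<close>

text \<open>Scaling the variable by \<open>1 / sqrt 2\<close> halves the exponent; composing
  \<open>p\<close> with the inverse scaling beforehand leaves the polynomial unchanged.\<close>

lemma integrable_gauss_half_poly: "integrable lborel (\<lambda>t::real. exp (- t\<^sup>2 / 2) * poly p t)"
  using lborel_integrable_real_affine[OF integrable_gauss_poly[of "p \<circ>\<^sub>p [:0, sqrt 2:]"], of "1 / sqrt 2" 0]
  by (simp add: poly_pcompose power_mult_distrib power_divide)

theorem corollary2p2: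
  fixes m :: nat and \<xi> :: real
  assumes "0 < \<xi>"
  defines "f \<equiv> \<lambda>\<eta>. exp (- \<eta> / 2) * laguerre m (- 1 / 2) \<eta> / ((\<eta> - \<xi>) * sqrt \<eta>)"
    and "g \<equiv> \<lambda>\<eta>. exp (- \<eta> / 2) * laguerre m (1 / 2) \<eta> * sqrt \<eta> / (\<eta> - \<xi>)"
  shows "pv_integrable UNIV (sqrt \<xi>) (G_integrand (2 * m) (sqrt \<xi>)) \<and>
    pv_integrable {0<..} \<xi> f \<and>
    1 / pi * pv_integral {0<..} \<xi> f =
      (- 1) ^ m * G (2 * m) (sqrt \<xi>) / (2 ^ (2 * m) * fact m * sqrt \<xi>) \<and>
    pv_integrable UNIV (sqrt \<xi>) (G_integrand (2 * m + 1) (sqrt \<xi>)) \<and>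
    pv_integrable {0<..} \<xi> g \<and>
    1 / pi * pv_integral {0<..} \<xi> g =
      (- 1) ^ m * G (2 * m + 1) (sqrt \<xi>) / (2 ^ (2 * m + 1) * fact m)"
proof -
  define x where "x = sqrt \<xi>"
  have x: "0 < x" "x\<^sup>2 = \<xi>"
    using assms(1) by (auto simp: x_def)
  define \<phi> where "\<phi> n t = exp (- t\<^sup>2 / 2) * poly (hermite n) t" for n t
  define F where "F n u = (\<phi> n (sqrt u) / (sqrt u - x) - \<phi> n (- sqrt u) / (sqrt u + x)) / (2 * sqrt u)" for n u
  have \<phi>: "integrable lborel (\<phi> n)" for n
    unfolding \<phi>_def[abs_def] by (rule integrable_gauss_half_poly)
  have D: "\<exists>D. (\<phi> n has_real_derivative D) (at x)" for n
    unfolding \<phi>_def[abs_def] by (intro exI) (auto intro!: derivative_eq_intros)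
  have Gi: "G_integrand n x = (\<lambda>t. \<phi> n t / (t - x))" for n
    by (simp add: G_integrand_def \<phi>_def fun_eq_iff)
  have 1: "pv_integrable UNIV x (G_integrand n x)" for n
    unfolding Gi using D[of n] pv_integrable_line[OF \<phi> _ x(1)] by blast
  have 2: "pv_integrable {0<..} \<xi> (F n)" for n
    unfolding F_def[abs_def] using D[of n] pv_integrable_half_line[OF \<phi> _ x(1)] x(2) by auto
  have 3: "1 / pi * pv_integral {0<..} \<xi> (F n) = G n x" for n
    unfolding F_def[abs_def] G_def Gi using D[of n] pv_integral_half_line[OF \<phi> _ x(1)] x(2) by auto
  \<comment> \<open>These invert the constants of \<open>hermite_laguerre\<close>, as
    \<open>(- 1) ^ m\<close> is its own inverse. The extra \<open>x\<close> in \<open>c\<close>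
    cancels the numerator in
    \<open>1 / (t - x) - 1 / (t + x) = 2 * x / (t\<^sup>2 - x\<^sup>2)\<close>.\<close>
  define c where "c = (- 1) ^ m / (2 ^ (2 * m) * fact m * x)"
  define d where "d = (- 1) ^ m / (2 ^ (2 * m + 1) * fact m :: real)"
  have inv: "(- 1) ^ m * ((- 1) ^ m * y) = (y :: real)" for y
    by (simp flip: mult.assoc power_mult_distrib)
  \<comment> \<open>The pole is excluded: at \<xi> division by zero makes \<open>f\<close> and
    \<open>g\<close> vanish, whereas \<open>F\<close> retains its \<open>sqrt u + x\<close>
    term.\<close>
  have fg: "f u = c * F (2 * m) u" "g u = d * F (2 * m + 1) u" if u: "u \<in> {0<..}" "u \<noteq> \<xi>" for u
  proof -
    define t where "t = sqrt u"
    have t: "0 < t" "t \<noteq> x" "u = t\<^sup>2"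
      using u x by (auto simp: t_def)
    have nz: "t - x \<noteq> 0" "t + x \<noteq> 0" "t \<noteq> 0" "t\<^sup>2 - x\<^sup>2 \<noteq> 0"
      using t x u by auto
    define E where "E = exp (- t\<^sup>2 / 2)"
    define K where "K = laguerre m (- 1 / 2) (t\<^sup>2)"
    define L where "L = laguerre m (1 / 2) (t\<^sup>2)"
    \<comment> \<open>Here \<open>\<phi> (2 * m)\<close> is even, so the two fractions are
      subtracted.\<close>
    have even: "F (2 * m) u = (- 1) ^ m * 2 ^ (2 * m) * fact m * (E * K * ((1 / (t - x) - 1 / (t + x)) / (2 * t)))"
      unfolding F_def t_def[symmetric] \<phi>_def hermite_laguerre power2_minus E_def[symmetric] K_def[symmetric]
      by (simp add: diff_divide_distrib algebra_simps)
    have "(1 / (t - x) - 1 / (t + x)) / (2 * t) = x / ((t\<^sup>2 - x\<^sup>2) * t)"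
      using nz by (simp add: divide_simps) (simp add: algebra_simps power2_eq_square)
    then have "c * F (2 * m) u = E * K / ((t\<^sup>2 - x\<^sup>2) * t)"
      unfolding even c_def using x(1) by (simp add: inv)
    then show "f u = c * F (2 * m) u"
      unfolding f_def x(2)[symmetric] t_def[symmetric] E_def K_def unfolding t(3) by simp
    \<comment> \<open>Here \<open>\<phi> (2 * m + 1)\<close> is odd, so the fractions add, and its
      factor \<open>t\<close> cancels the one from the Jacobian.\<close>
    have odd: "F (2 * m + 1) u =
        (- 1) ^ m * 2 ^ (2 * m + 1) * fact m * (E * L * (t * (1 / (t - x) + 1 / (t + x)) / (2 * t)))"
      unfolding F_def t_def[symmetric] \<phi>_def hermite_laguerre power2_minus E_def[symmetric] L_def[symmetric]
      by (simp add: diff_divide_distrib add_divide_distrib algebra_simps)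
    have "t * (1 / (t - x) + 1 / (t + x)) / (2 * t) = t / (t\<^sup>2 - x\<^sup>2)"
      using nz by (simp add: divide_simps) (simp add: algebra_simps power2_eq_square)
    then have "d * F (2 * m + 1) u = E * L * t / (t\<^sup>2 - x\<^sup>2)"
      unfolding odd d_def by (simp add: inv)
    then show "g u = d * F (2 * m + 1) u"
      unfolding g_def x(2)[symmetric] t_def[symmetric] E_def L_def unfolding t(3) by simp
  qed
  have f: "pv_integrable {0<..} \<xi> f" "pv_integral {0<..} \<xi> f = c * pv_integral {0<..} \<xi> (F (2 * m))"
    by (rule pv_integrable_cmult[OF 2] pv_integral_cmult[OF 2]; rule fg; assumption)+
  have g: "pv_integrable {0<..} \<xi> g" "pv_integral {0<..} \<xi> g = d * pv_integral {0<..} \<xi> (F (2 * m + 1))"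
    by (rule pv_integrable_cmult[OF 2] pv_integral_cmult[OF 2]; rule fg; assumption)+
  have "1 / pi * pv_integral {0<..} \<xi> f = c * (1 / pi * pv_integral {0<..} \<xi> (F (2 * m)))"
    "1 / pi * pv_integral {0<..} \<xi> g = d * (1 / pi * pv_integral {0<..} \<xi> (F (2 * m + 1)))"
    unfolding f g by simp_all
  then show ?thesis
    unfolding 3 using 1 f(1) g(1) by (simp add: c_def d_def x_def)
qed

end
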